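(* Let $R$ be a $*$-ring and let $a,b,c\in R$ with $r(b)=r(c)$. Then $a\in R_{rh(b,c)}^{\mathrm{core}}$ (i.e. $a$ has a right hybrid core-$(b,c)$-inverse) if and only if both of the following hold: (1) $ab$ is EP; (2) $r(ab)=r(b)$, $(ab)^{\pi}b=0$ and $(ba)^{\pi}a=0$.
   Context: A $*$-ring is an associative ring with identity with an involution $x\mapsto x^*$ satisfying $(x+y)^*=x^*+y^*$, $(xy)^*=y^*x^*$, $(x^* )^*=x$. For $x\in R$, $r(x)=\{y\in R: xy=0\}$. Core inverse: $a\in R$ is core invertible ($a\in R^{\mathrm{core}}$) if there is $x\in R$ with $ax^2=x$, $(ax)^*=ax$, $xa^2=a$; such $x$ is unique and denoted $a^{\mathrm{core}}$. Right hybrid $(b,c)$-inverse: $a\in R_{rh}^{(b,c)}$ if there is $x\in R$ with $xax=x$, $xR=bR$, $r(x)=r(c)$; such $x$ is unique and denoted $a_{rh}^{(b,c)}$. Right hybrid core-$(b,c)$-inverse: $a\in R_{rh(b,c)}^{\mathrm{core}}$ if $a\in R^{\mathrm{core}}$, $a\in R_{rh}^{(b,c)}$ and $a^{\mathrm{core}}=a_{rh}^{(b,c)}$. Drazin inverse: $x\in R$ is Drazin invertible if there is $z=x^D$ with $xz=zx$, $zxz=z$, $x^{k+1}z=x^k$ for some $k\in\mathbb N$; if one can take $k=1$, $x$ is group invertible and $x^D=x^{\#}$. For Drazin invertible $x$, $x^{\pi}=1-xx^D$. An element $x$ is EP if it is group invertible and $(xx^{\#})^*=xx^{\#}$. (If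 $ab$ is EP then $ab$ and $ba$ are Drazin invertible, so the expressions in (2) make sense.) *)

theory Defs
  imports Main
begin

(* Built on ring + monoid_mult rather than ring_1: the latter demands 0 \<noteq> 1 and would
   exclude the zero ring. *)
class star_ring = ring + monoid_mult +
  fixes star :: "'a \<Rightarrow> 'a"
  assumes star_add: "star (x + y) = star x + star y"
    and star_mult: "star (x * y) = star y * star x"
    and star_star: "star (star x) = x"

definition right_annihilator :: "'a::star_ring \<Rightarrow> 'a set" where
  "right_annihilator x = {y. x * y = 0}"

definition principal_right_ideal :: "'a::star_ring \<Rightarrow> 'a set" where
  "principal_right_ideal x = {x * y | y. True}"


definition is_core_inverse :: "'a::star_ring \<Rightarrow> 'a \<Rightarrow> bool" where
  "is_core_inverse a x \<longleftrightarrow> a * x\<^sup>2 = x \<and> star (a * x) = a * x \<and> x * a\<^sup>2 = a"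

definition core_invertible :: "'a::star_ring \<Rightarrow> bool" where
  "core_invertible a \<longleftrightarrow> (\<exists>x. is_core_inverse a x)"

definition core_inverse :: "'a::star_ring \<Rightarrow> 'a" where
  "core_inverse a = (THE x. is_core_inverse a x)"

lemma core_inverse_inner:
  assumes "is_core_inverse a x"
  shows "a * x * a = a" and "x * a * x = x"
proof -
  have 1: "a * (x * x) = x" and 3: "x * (a * a) = a"
    using assms by (auto simp: is_core_inverse_def power2_eq_square)
  have "a * x * a = a * x * (x * (a * a))" using 3 by simp
  also have "\<dots> = a * (x * x) * (a * a)" by (simp only: mult.assoc)
  finally show "a * x * a = a" using 1 3 by simp
  have "x * a * x = x * a * (a * (x * x))" using 1 by simp
  also have "\<dots> = x * (a * a) * (x * x)" by (simp only: mult.assoc)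
  finally show "x * a * x = x" using 1 3 by simp
qed

lemma core_inverse_unique:
  assumes x: "is_core_inverse a x" and y: "is_core_inverse a y"
  shows "x = y"
proof -
  have "a * x = a * y * (a * x)"
    using core_inverse_inner(1)[OF y] by (simp flip: mult.assoc)
  then have "star (a * x) = star (a * y * (a * x))" by simp
  then have "a * x = a * x * (a * y)"
    using x y by (simp add: star_mult[of "a * y"] is_core_inverse_def)
  also have "\<dots> = a * y"
    using core_inverse_inner(1)[OF x] by (simp flip: mult.assoc)
  finally have eq: "a * x = a * y" .
  have "x = x * (a * y)"
    using core_inverse_inner(2)[OF x] eq by (simp add: mult.assoc)
  also have "\<dots> = x * (a * (a * y\<^sup>2))" using y by (simp add: is_core_inverse_def)
  also have "\<dots> = (x * a\<^sup>2) * y\<^sup>2" by (simp only: mult.assoc power2_eq_square)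
  also have "\<dots> = y" using x y by (simp add: is_core_inverse_def)
  finally show ?thesis .
qed

lemma core_inverse_eqI: "is_core_inverse a x \<Longrightarrow> core_inverse a = x"
  unfolding core_inverse_def by (blast intro: core_inverse_unique)


definition is_rh_inverse :: "'a::star_ring \<Rightarrow> 'a \<Rightarrow> 'a \<Rightarrow> 'a \<Rightarrow> bool" where
  "is_rh_inverse b c a x \<longleftrightarrow> x * a * x = x \<and>
     principal_right_ideal x = principal_right_ideal b \<and>
     right_annihilator x = right_annihilator c"

definition rh_invertible :: "'a::star_ring \<Rightarrow> 'a \<Rightarrow> 'a \<Rightarrow> bool" where
  "rh_invertible b c a \<longleftrightarrow> (\<exists>x. is_rh_inverse b c a x)"

definition rh_inverse :: "'a::star_ring \<Rightarrow> 'a \<Rightarrow> 'a \<Rightarrow> 'a" where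
  "rh_inverse b c a = (THE x. is_rh_inverse b c a x)"

lemma rh_inverse_unique:
  assumes x: "is_rh_inverse b c a x" and y: "is_rh_inverse b c a y"
  shows "x = y"
proof -
  have "y * 1 \<in> principal_right_ideal x"
    using x y unfolding is_rh_inverse_def principal_right_ideal_def by blast
  then obtain t where t: "y = x * t" by (auto simp: principal_right_ideal_def)
  have "x * a * y = x * a * x * t" by (simp add: t mult.assoc)
  then have *: "x * a * y = y" using x t by (simp add: is_rh_inverse_def)
  have "y * (a * y - 1) = 0"
    using y by (simp add: is_rh_inverse_def right_diff_distrib flip: mult.assoc)
  then have "x * (a * y - 1) = 0"
    using x y by (auto simp: is_rh_inverse_def right_annihilator_def)
  then have "x * a * y = x" by (simp add: right_diff_distrib flip: mult.assoc)
  with * show ?thesis by simp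
qed

lemma rh_inverse_eqI: "is_rh_inverse b c a x \<Longrightarrow> rh_inverse b c a = x"
  unfolding rh_inverse_def by (blast intro: rh_inverse_unique)

definition rh_core_invertible :: "'a::star_ring \<Rightarrow> 'a \<Rightarrow> 'a \<Rightarrow> bool" where
  "rh_core_invertible b c a \<longleftrightarrow>
     core_invertible a \<and> rh_invertible b c a \<and> core_inverse a = rh_inverse b c a"


(* The third equation passes from k to Suc k, so allowing k = 0 (where x is a unit) does not
   enlarge the class of Drazin invertible elements. *)
definition is_drazin_inverse_at :: "nat \<Rightarrow> 'a::star_ring \<Rightarrow> 'a \<Rightarrow> bool" where
  "is_drazin_inverse_at k x z \<longleftrightarrow> x * z = z * x \<and> z * x * z = z \<and> x ^ (k + 1) * z = x ^ k"

definition drazin_invertible :: "'a::star_ring \<Rightarrow> bool" where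
  "drazin_invertible x \<longleftrightarrow> (\<exists>z k. is_drazin_inverse_at k x z)"

definition drazin_inverse :: "'a::star_ring \<Rightarrow> 'a" where
  "drazin_inverse x = (THE z. \<exists>k. is_drazin_inverse_at k x z)"

definition group_invertible :: "'a::star_ring \<Rightarrow> bool" where
  "group_invertible x \<longleftrightarrow> (\<exists>z. is_drazin_inverse_at 1 x z)"

definition group_inverse :: "'a::star_ring \<Rightarrow> 'a" where
  "group_inverse x = (THE z. is_drazin_inverse_at 1 x z)"

definition spectral_idempotent :: "'a::star_ring \<Rightarrow> 'a" where
  "spectral_idempotent x = 1 - x * drazin_inverse x"

definition EP :: "'a::star_ring \<Rightarrow> bool" where
  "EP x \<longleftrightarrow> group_invertible x \<and> star (x * group_inverse x) = x * group_inverse x"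

lemma is_drazin_inverse_at_mono:
  assumes "is_drazin_inverse_at k x z" "k \<le> m"
  shows "is_drazin_inverse_at m x z"
proof -
  have "x ^ (m + 1) * z = x ^ (m - k) * (x ^ (k + 1) * z)"
    using assms(2) by (simp flip: mult.assoc power_add power_Suc)
  also have "\<dots> = x ^ m"
    using assms by (simp add: is_drazin_inverse_at_def flip: power_add)
  finally show ?thesis using assms(1) by (simp add: is_drazin_inverse_at_def)
qed

lemma drazin_power:
  assumes "is_drazin_inverse_at k x z"
  shows "x * z = x ^ Suc m * z ^ Suc m"
proof (induction m)
  case (Suc m)
  have c: "x * z = z * x" "z * x * z = z"
    using assms by (auto simp: is_drazin_inverse_at_def)
  then have i: "x * z * z = z" by simp
  have "x ^ Suc (Suc m) * z ^ Suc (Suc m) = x ^ Suc m * (x * z * z) * z ^ m"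
    by (simp only: power_Suc2[of x "Suc m"] power_Suc[of z] mult.assoc)
  also have "\<dots> = x ^ Suc m * z ^ Suc m" unfolding i by (simp add: mult.assoc)
  finally show ?case using Suc by simp
qed simp

lemma drazin_inverse_unique:
  assumes "is_drazin_inverse_at k x z" "is_drazin_inverse_at l x w"
  shows "z = w"
proof -
  define m where "m = Suc (max k l)"
  have z: "is_drazin_inverse_at m x z" and w: "is_drazin_inverse_at m x w"
    by (rule is_drazin_inverse_at_mono[OF assms(1)], simp add: m_def,
        rule is_drazin_inverse_at_mono[OF assms(2)], simp add: m_def)
  have zc: "x * z = z * x" "z * x * z = z" "x ^ m * x * z = x ^ m"
    using z by (simp_all add: is_drazin_inverse_at_def power_Suc2 flip: power_Suc)
  have wc: "x * w = w * x" "w * x * w = w" "x ^ m * x * w = x ^ m"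
    using w by (simp_all add: is_drazin_inverse_at_def power_Suc2 flip: power_Suc)
  have zm: "x * z = x ^ m * z ^ m" using drazin_power[OF z] by (simp only: m_def)
  have wm: "x * w = x ^ m * w ^ m" using drazin_power[OF w] by (simp only: m_def)
  have comm: "w ^ m * x ^ m = x ^ m * w ^ m"
    using wc(1) by (metis power_commuting_commutes)
  have commx: "w * x ^ m = x ^ m * w"
    using wc(1) by (metis power_commuting_commutes)
  have "x * w * (x * z) = w ^ m * (x ^ m * x * z)" by (simp add: wm mult.assoc flip: comm)
  also have "\<dots> = x * w" by (simp add: zc wm comm)
  finally have 1: "x * w * (x * z) = x * w" .
  have "x * w * (x * z) = x * (w * x ^ m) * z ^ m" by (simp add: zm mult.assoc)
  also have "\<dots> = (x ^ m * x * w) * z ^ m"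
    by (simp add: commx power_commutes flip: mult.assoc)
  also have "\<dots> = x * z" by (simp add: wc zm)
  finally have eq: "x * w = x * z" using 1 by simp
  have "z = z * (x * w)" using zc eq by (simp add: mult.assoc)
  also have "\<dots> = z * x * w" by (simp only: mult.assoc)
  also have "\<dots> = x * w * w" by (simp only: eq flip: zc(1))
  also have "\<dots> = w" using wc by simp
  finally show ?thesis .
qed

lemma drazin_inverse_eqI: "is_drazin_inverse_at k x z \<Longrightarrow> drazin_inverse x = z"
  unfolding drazin_inverse_def by (blast intro: drazin_inverse_unique)

lemma group_inverse_eqI: "is_drazin_inverse_at 1 x z \<Longrightarrow> group_inverse x = z"
  unfolding group_inverse_def by (blast intro: drazin_inverse_unique)

lemma group_inverse_eq_drazin_inverse:
  "group_invertible x \<Longrightarrow> group_inverse x = drazin_inverse x"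
  unfolding group_invertible_def by (metis group_inverse_eqI drazin_inverse_eqI)

lemma EP_imp_drazin_invertible:
  assumes "EP (a * b)"
  shows "drazin_invertible (a * b)" and "drazin_invertible (b * a)"
proof -
  obtain z where z: "is_drazin_inverse_at 1 (a * b) z"
    using assms by (auto simp: EP_def group_invertible_def)
  then show "drazin_invertible (a * b)" by (auto simp: drazin_invertible_def)
  have c: "a * b * z = z * (a * b)" "z * (a * b) * z = z" "a * b * (a * b) * z = a * b"
    using z by (simp_all add: is_drazin_inverse_at_def)
  define y where "y = b * z * z * a"
  have i: "a * b * z * z = z" "z * z * (a * b) = z"
    using c(1,2) by (simp_all add: mult.assoc)
  have L: "b * a * y = b * z * a"
  proof -
    have "b * a * y = b * (a * b * z * z) * a" by (simp only: y_def mult.assoc)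
    then show ?thesis by (simp only: i)
  qed
  have Rr: "y * (b * a) = b * z * a"
  proof -
    have "y * (b * a) = b * (z * z * (a * b)) * a" by (simp only: y_def mult.assoc)
    then show ?thesis by (simp only: i)
  qed
  have I: "y * (b * a) * y = y"
  proof -
    have "y * (b * a) * y = b * (z * (a * b) * z) * z * a"
      unfolding Rr by (simp only: y_def mult.assoc)
    then show ?thesis by (simp only: c y_def)
  qed
  have "(b * a) ^ (2 + 1) * y = b * a * (b * a) * (b * a * y)"
    by (simp add: numeral_3_eq_3 mult.assoc)
  also have "\<dots> = b * (a * b * (a * b) * z) * a" unfolding L by (simp only: mult.assoc)
  also have "\<dots> = (b * a) ^ 2" unfolding c by (simp only: power2_eq_square mult.assoc)
  finally have "is_drazin_inverse_at 2 (b * a) y"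
    using L Rr I by (simp add: is_drazin_inverse_at_def)
  then show "drazin_invertible (b * a)" by (auto simp: drazin_invertible_def)
qed

end

theory Submission
  imports Defs
begin

text \<open>
  If \<open>z\<close> is the group inverse of \<open>ab\<close>, the common inverse is \<open>x = bz\<close>. Conversely, if \<open>x = bt\<close>
  is both the core inverse and the right hybrid \<open>(b,c)\<close>-inverse of \<open>a\<close>, then \<open>axt\<close> is the group
  inverse of \<open>ab\<close> and the associated idempotent is the projection \<open>ax\<close>. In both directions
  Cline's formula \<open>(ba)\<^sup>D = b ((ab)\<^sup>D)\<^sup>2 a\<close> turns \<open>(ba)\<^sup>\<pi> a = 0\<close> into \<open>b z a a = a\<close>.
\<close>

lemma mult_power_swap:
  fixes a b :: "'a::monoid_mult"
  shows "(b * a) ^ Suc k = b * (a * b) ^ k * a"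
  by (induction k) (simp_all add: mult.assoc)

text \<open>Cline's formula. Both products of \<open>b * a\<close> with the candidate collapse to
  \<open>b * z * a\<close>, because \<open>a * b * z * z = z\<close>. The index rises by one since
  \<open>(b * a) ^ Suc k\<close> contains only the \<open>k\<close>-th power of
  \<open>a * b\<close>.\<close>

lemma drazin_inverse_at_cline:
  fixes a b z :: "'a::star_ring"
  assumes "is_drazin_inverse_at k (a * b) z"
  shows "is_drazin_inverse_at (Suc k) (b * a) (b * z * z * a)"
    and "b * a * (b * z * z * a) = b * z * a"
proof -
  have c: "a * b * z = z * (a * b)" "z * (a * b) * z = z"
    and p: "(a * b) ^ Suc k * z = (a * b) ^ k"
    using assms by (simp_all add: is_drazin_inverse_at_def)
  have i: "a * b * z * z = z" "z * z * (a * b) = z"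
    using c by (simp_all add: mult.assoc)
  have "b * a * (b * z * z * a) = b * (a * b * z * z) * a" by (simp only: mult.assoc)
  then show left: "b * a * (b * z * z * a) = b * z * a" by (simp only: i)
  have "b * z * z * a * (b * a) = b * (z * z * (a * b)) * a" by (simp only: mult.assoc)
  then have right: "b * z * z * a * (b * a) = b * z * a" by (simp only: i)
  have "b * z * a * (b * z * z * a) = b * (z * (a * b) * z) * z * a" by (simp only: mult.assoc)
  then have inner: "b * z * a * (b * z * z * a) = b * z * z * a" by (simp only: c)
  have "(b * a) ^ (Suc k + 1) * (b * z * z * a) = (b * a) ^ Suc k * (b * z * a)"
    by (simp only: Suc_eq_plus1[symmetric] power_Suc2[of _ "Suc k"] mult.assoc[of "_ ^ _"] left)
  also have "\<dots> = b * ((a * b) ^ Suc k * z) * a"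
    by (simp only: mult_power_swap[of b a] power_Suc2[of "a * b"] mult.assoc)
  also have "\<dots> = (b * a) ^ Suc k" by (simp only: p mult_power_swap[of b a])
  finally show "is_drazin_inverse_at (Suc k) (b * a) (b * z * z * a)"
    unfolding is_drazin_inverse_at_def using left right inner by simp
qed

lemma spectral_idempotent_eq:
  "is_drazin_inverse_at k x z \<Longrightarrow> spectral_idempotent x = 1 - x * z"
  by (simp add: spectral_idempotent_def drazin_inverse_eqI)

lemma spectral_idempotent_swap:
  fixes a b z :: "'a::star_ring"
  assumes "is_drazin_inverse_at k (a * b) z"
  shows "spectral_idempotent (b * a) = 1 - b * z * a"
  using drazin_inverse_at_cline[OF assms] by (simp only: spectral_idempotent_eq)

lemma EP_iff: "EP x \<longleftrightarrow> (\<exists>z. is_drazin_inverse_at 1 x z \<and> star (x * z) = x * z)"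
  by (auto simp: EP_def group_invertible_def group_inverse_eqI)

text \<open>Both inverses are unique, so equality of the two definite descriptions amounts to a
  shared witness.\<close>

lemma rh_core_invertible_iff:
  "rh_core_invertible b c a \<longleftrightarrow> (\<exists>x. is_core_inverse a x \<and> is_rh_inverse b c a x)"
  unfolding rh_core_invertible_def core_invertible_def rh_invertible_def
  by (metis core_inverse_eqI rh_inverse_eqI)

lemma in_principal_right_ideal: "(x::'a::star_ring) \<in> principal_right_ideal x"
  unfolding principal_right_ideal_def by (simp, metis mult_1_right)

lemma principal_right_ideal_eqI:
  fixes x y :: "'a::star_ring"
  assumes "x = y * s" "y = x * t"
  shows "principal_right_ideal x = principal_right_ideal y"
  using assms unfolding principal_right_ideal_def by (auto, metis mult.assoc, metis mult.assoc)

text \<open>Applied to \<open>u - v\<close>, equality of annihilators transfers equations from one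
  left factor to another. Below, \<open>v\<close> is always 1.\<close>

lemma right_annihilatorD:
  fixes x y :: "'a::star_ring"
  assumes "right_annihilator x = right_annihilator y" "x * u = x * v"
  shows "y * u = y * v"
proof -
  have "u - v \<in> right_annihilator x"
    using assms(2) by (simp add: right_annihilator_def right_diff_distrib)
  then have "u - v \<in> right_annihilator y" using assms(1) by simp
  then show ?thesis by (simp add: right_annihilator_def right_diff_distrib)
qed

lemma right_annihilator_mult_left:
  fixes x y :: "'a::star_ring"
  assumes "x = u * y" "y = v * x"
  shows "right_annihilator x = right_annihilator y"
  using assms unfolding right_annihilator_def
  by (auto, metis mult.assoc mult_zero_right, metis mult.assoc mult_zero_right)

lemma core_rh_inverse_imp:
  fixes a b c x :: "'a::star_ring"
  assumes ann: "right_annihilator b = right_annihilator c"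
    and core: "is_core_inverse a x" and rh: "is_rh_inverse b c a x"
  shows "EP (a * b)" and "right_annihilator (a * b) = right_annihilator b"
    and "spectral_idempotent (a * b) * b = 0" and "spectral_idempotent (b * a) * a = 0"
proof -
  have axx: "a * x * x = x" and star: "star (a * x) = a * x" and xaa: "x * a * a = a"
    using core by (simp_all add: is_core_inverse_def power2_eq_square mult.assoc)
  have xax: "x * a * x = x" and R: "principal_right_ideal x = principal_right_ideal b"
    and ann': "right_annihilator x = right_annihilator b"
    using rh ann by (simp_all add: is_rh_inverse_def)
  obtain s t where s: "b = x * s" and t: "x = b * t"
    using R in_principal_right_ideal[of x] in_principal_right_ideal[of b]
    unfolding principal_right_ideal_def by blast
  have xab: "x * a * b = b" using s xax by (metis mult.assoc)
  have axb: "a * x * b = b" using s axx by (metis mult.assoc)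
  have bax: "b * (a * x) = b"
    using right_annihilatorD[OF ann', of "a * x" 1] xax by (simp add: mult.assoc)
  \<comment> \<open>The transfer now runs from \<open>b\<close> back to \<open>x\<close>, using
    \<open>b * t = x\<close>.\<close>
  have "b * (t * a * b) = b * 1" using xab t by (simp add: mult.assoc)
  then have xtab: "x * (t * a * b) = x"
    using right_annihilatorD[OF ann'[symmetric]] by fastforce
  \<comment> \<open>Already \<open>a * b * t = a * x\<close>. The prefix \<open>a * x\<close>
    preserves this, as \<open>b * (a * x) = b\<close>, and moreover gives
    \<open>z * (a * b) = a * x\<close> and \<open>a * x * z = z\<close>.\<close>
  define z where "z = a * x * t"
  have bz: "b * z = x" unfolding z_def using bax t by (metis mult.assoc)
  then have abz: "a * b * z = a * x" by (simp add: mult.assoc)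
  have zab: "z * (a * b) = a * x" unfolding z_def using xtab by (simp add: mult.assoc)
  have "a * x * z = z" unfolding z_def using xax by (metis mult.assoc)
  moreover have "(a * b) ^ (1 + 1) * z = a * b"
    using abz bax by (simp add: mult.assoc)
  ultimately have D: "is_drazin_inverse_at 1 (a * b) z"
    by (simp add: is_drazin_inverse_at_def abz zab)
  then show "EP (a * b)" using abz star by (metis EP_iff)
  show "right_annihilator (a * b) = right_annihilator b"
    using xab by (intro right_annihilator_mult_left[of _ a _ x]) (simp_all add: mult.assoc)
  show "spectral_idempotent (a * b) * b = 0"
    using axb by (simp add: spectral_idempotent_eq[OF D] abz left_diff_distrib)
  show "spectral_idempotent (b * a) * a = 0"
    using xaa by (simp add: spectral_idempotent_swap[OF D] bz left_diff_distrib)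
qed

lemma core_rh_inverse_exists:
  fixes a b c :: "'a::star_ring"
  assumes ann: "right_annihilator b = right_annihilator c" and EP: "EP (a * b)"
    and r: "right_annihilator (a * b) = right_annihilator b"
    and sab: "spectral_idempotent (a * b) * b = 0"
    and sba: "spectral_idempotent (b * a) * a = 0"
  shows "\<exists>x. is_core_inverse a x \<and> is_rh_inverse b c a x"
proof -
  obtain z where D: "is_drazin_inverse_at 1 (a * b) z" and star: "star (a * b * z) = a * b * z"
    using EP by (auto simp: EP_iff)
  have c: "a * b * z = z * (a * b)" "z * (a * b) * z = z" "a * b * (a * b) * z = a * b"
    using D by (simp_all add: is_drazin_inverse_at_def)
  \<comment> \<open>With \<open>x = b * z\<close>, the two spectral conditions yield
    \<open>a * x * x = x\<close> and \<open>x * a * a = a\<close>; self-adjointness of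
    \<open>a * x\<close> is the EP condition.\<close>
  have abzb: "a * b * z * b = b"
    using sab by (simp add: spectral_idempotent_eq[OF D] left_diff_distrib)
  have bzaa: "b * z * a * a = a"
    using sba by (simp add: spectral_idempotent_swap[OF D] left_diff_distrib)
  \<comment> \<open>The hypothesis \<open>r\<close> cancels the left factor \<open>a\<close>, which
    makes \<open>b\<close> a right multiple of \<open>b * z\<close>.\<close>
  have "a * b * (z * (a * b)) = a * b * 1" using c by (metis mult.assoc mult_1_right)
  then have bzab: "b * (z * (a * b)) = b" using right_annihilatorD[OF r] by fastforce
  have "a * (b * z)\<^sup>2 = a * b * z * b * z" by (simp add: power2_eq_square mult.assoc)
  also have "\<dots> = b * z" by (simp only: abzb)
  finally have core: "is_core_inverse a (b * z)"
    using star bzaa by (simp add: is_core_inverse_def power2_eq_square mult.assoc)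
  have "b * z * a * (b * z) = b * (z * (a * b) * z)" by (simp only: mult.assoc)
  then have "b * z * a * (b * z) = b * z" by (simp only: c)
  moreover have "principal_right_ideal (b * z) = principal_right_ideal b"
    using bzab by (intro principal_right_ideal_eqI[of _ _ z "a * b"]) (simp_all add: mult.assoc)
  \<comment> \<open>The comparison is with \<open>a * b\<close>, since it and \<open>b * z\<close>
    are left multiples of each other; \<open>r\<close> and \<open>ann\<close> then lead on to
    \<open>c\<close>.\<close>
  moreover have "right_annihilator (b * z) = right_annihilator (a * b)"
  proof (rule right_annihilator_mult_left[of _ "b * z * z" _ "a * b * a"])
    show "b * z = b * z * z * (a * b)" using c by (metis mult.assoc)
    show "a * b = a * b * a * (b * z)" using c by (metis mult.assoc)
  qed
  ultimately have "is_rh_inverse b c a (b * z)" using ann r by (simp add: is_rh_inverse_def)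
  with core show ?thesis by blast
qed

theorem theorem3p3:
  fixes a b c :: "'a::star_ring"
  assumes "right_annihilator b = right_annihilator c"
  shows "rh_core_invertible b c a \<longleftrightarrow>
    EP (a * b) \<and>
    (right_annihilator (a * b) = right_annihilator b \<and>
     spectral_idempotent (a * b) * b = 0 \<and>
     spectral_idempotent (b * a) * a = 0)"
  unfolding rh_core_invertible_iff
  using core_rh_inverse_imp[OF assms] core_rh_inverse_exists[OF assms] by blast

end
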